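(* In the first-best problem, denote by $x$ the Agent's reservation value, and let $\lambda_{Lag}(x)$ be the Lagrange multiplier, solution of $G(\lambda_{Lag})=x$ where $$G(\lambda_{Lag})=\int_0^\infty e^{-\lambda s}\left(U\Big((U')^{-1}\big(\tfrac{1}{\lambda_{Lag}}e^{(\lambda-\delta)s}\big)\Big)-h\Big(\big(\tfrac{h'}{\varphi'}\big)^{-1}\big(\tfrac{1}{\lambda_{Lag}}e^{(\lambda-\delta)s}\big)\vee 0\Big)\right)ds,$$ and set $R_t^*(x)=(U')^{-1}\big(\tfrac{1}{\lambda_{Lag}(x)}e^{(\lambda-\delta)t}\big)$, $A_t^*(x)=(\tfrac{h'}{\varphi'})^{-1}\big(\tfrac{1}{\lambda_{Lag}(x)}e^{(\lambda-\delta)t}\big)\vee0$ and $H_t(x)=\varphi(A^*_t(x))-R^*_t(x)$. In the non-degenerate case $\tau^*\neq0$ (the optimal stopping time of the first-best problem is not $0$): (1) for each $t$, the optimal rent $R^*_t(x)$ is increasing and the optimal effort $A^*_t(x)$ is decreasing with respect to $x$; (2) for each $t$, the function $x\mapsto H_t(x)$ is decreasing.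
   Context: First-best problem: maximize $\mathbb{E}[\int_0^\tau e^{-\delta s}(\varphi(A_s)-R_s)ds-e^{-\delta\tau}\xi]$ over quadruplets $(R,\tau,\xi,A)$ with $R,A\ge0$ progressively measurable with respect to the Brownian filtration $\mathbb{F}$, $\tau$ an $\mathbb{F}$-stopping time, $\xi\ge0$ $\mathcal{F}_\tau$-measurable (with suitable integrability), subject to the reservation constraint $\mathbb{E}[\int_0^\tau e^{-\lambda s}(U(R_s)-h(A_s))ds+e^{-\lambda\tau}U(\xi)]\ge x$, where $x>0$. Standing assumptions: $\varphi:[0,\infty)\to[0,\infty)$ is $C^2$, strictly concave, bounded, increasing, $\varphi(0)=0$, $\varphi'(0)>0$; $U:[0,\infty)\to[0,\infty)$ is $C^2$, strictly concave, increasing, $U(0)=0$, $U'(\infty)=0$, $U'(0)=\infty$; $h:[0,\infty)\to[0,\infty)$ is $C^2$, strictly convex, increasing, $h(0)=0$, $h'(0)>0$; $\lambda\ge\delta>0$. The notation $(h'/\varphi')^{-1}(y)\vee0$ means the inverse of $h'/\varphi'$ at $y$ when defined and nonnegative, and $0$ otherwise. *)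

theory Defs
  imports "HOL-Analysis.Analysis"
begin

definition strict_convex_on :: "real set \<Rightarrow> (real \<Rightarrow> real) \<Rightarrow> bool" where
  "strict_convex_on S f \<longleftrightarrow> convex S \<and>
     (\<forall>x\<in>S. \<forall>y\<in>S. \<forall>u. x \<noteq> y \<longrightarrow> 0 < u \<longrightarrow> u < 1 \<longrightarrow>
        f (u * x + (1 - u) * y) < u * f x + (1 - u) * f y)"

definition strict_concave_on :: "real set \<Rightarrow> (real \<Rightarrow> real) \<Rightarrow> bool" where
  "strict_concave_on S f \<longleftrightarrow> strict_convex_on S (\<lambda>x. - f x)"

definition C2_with :: "real set \<Rightarrow> (real \<Rightarrow> real) \<Rightarrow> (real \<Rightarrow> real) \<Rightarrow> (real \<Rightarrow> real) \<Rightarrow> bool" where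
  "C2_with S f f' f'' \<longleftrightarrow>
     (\<forall>x\<in>S. (f has_real_derivative f' x) (at x within S)) \<and>
     (\<forall>x\<in>S. (f' has_real_derivative f'' x) (at x within S)) \<and>
     continuous_on S f''"

definition invU' :: "(real \<Rightarrow> real) \<Rightarrow> real \<Rightarrow> real" where
  "invU' U' y = inv_into {0<..} U' y"

text \<open>(h'/\<phi>')^{-1}(y) \<or> 0: the (nonnegative) inverse of h'/\<phi>' at y when defined, and 0 otherwise.\<close>
definition invratio0 :: "(real \<Rightarrow> real) \<Rightarrow> (real \<Rightarrow> real) \<Rightarrow> real \<Rightarrow> real" where
  "invratio0 h' \<phi>' y =
     (if y \<in> (\<lambda>a. h' a / \<phi>' a) ` {0..} then inv_into {0..} (\<lambda>a. h' a / \<phi>' a) y else 0)"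

definition Gfun :: "(real \<Rightarrow> real) \<Rightarrow> (real \<Rightarrow> real) \<Rightarrow> (real \<Rightarrow> real) \<Rightarrow> (real \<Rightarrow> real) \<Rightarrow> (real \<Rightarrow> real)
                    \<Rightarrow> real \<Rightarrow> real \<Rightarrow> real \<Rightarrow> real" where
  "Gfun U U' h h' \<phi>' lam delta L =
     (LINT s:{0..}|lborel. exp (- lam * s) *
        (U (invU' U' (exp ((lam - delta) * s) / L))
         - h (invratio0 h' \<phi>' (exp ((lam - delta) * s) / L))))"

definition Rstar :: "(real \<Rightarrow> real) \<Rightarrow> real \<Rightarrow> real \<Rightarrow> real \<Rightarrow> real \<Rightarrow> real" where
  "Rstar U' lam delta L t = invU' U' (exp ((lam - delta) * t) / L)"

definition Astar :: "(real \<Rightarrow> real) \<Rightarrow> (real \<Rightarrow> real) \<Rightarrow> real \<Rightarrow> real \<Rightarrow> real \<Rightarrow> real \<Rightarrow> real" where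
  "Astar h' \<phi>' lam delta L t = invratio0 h' \<phi>' (exp ((lam - delta) * t) / L)"

end

theory Submission
  imports Defs
begin

text \<open>
  The integrand of G is nondecreasing in the multiplier L: U and h are nondecreasing,
  the inverse of U' is decreasing and the truncated inverse of h'/\<phi>' is nondecreasing.
  So G is nondecreasing, and the solution L(x) of G(L) = x is nondecreasing in x. The common
  argument exp((\<lambda> - \<delta>) t) / L(x) of both inverses thus decreases in x, so that R* increases
  while A* and \<phi>(A*) - R* decrease.

  U' is decreasing and maps
  (0, \<infinity>) onto itself by the intermediate value theorem. The ratio h'/\<phi>' is nondecreasing on
  [0, \<infinity>) because \<phi>' > 0 (strict concavity plus monotonicity), and it is unbounded because a
  bounded concave \<phi> has \<phi>'(a) a \<le> 2 sup |\<phi>|; so its range is an up-set and the truncated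
  inverse is monotone. No discounting assumption is needed.
\<close>

lemma strict_convex_on_imp_convex_on:
  fixes f :: "real \<Rightarrow> real"
  assumes "strict_convex_on S f"
  shows "convex_on S f"
proof (rule convex_on_linorderI)
  show "convex S" using assms by (simp add: strict_convex_on_def)
  fix t x y :: real assume "0 < t" "t < 1" "x \<in> S" "y \<in> S" "x < y"
  then have "f (t * y + (1 - t) * x) < t * f y + (1 - t) * f x"
    using assms unfolding strict_convex_on_def by auto
  then show "f ((1 - t) *\<^sub>R x + t *\<^sub>R y) \<le> (1 - t) * f x + t * f y"
    by (simp add: algebra_simps)
qed

lemma convex_on_above_tangent_within:
  fixes f :: "real \<Rightarrow> real"
  assumes convex: "convex_on S f" and "connected S" and "c \<in> S" "x \<in> S"
    and deriv: "(f has_real_derivative D) (at c within S)"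
  shows "D * (x - c) \<le> f x - f c"
proof (cases x c rule: linorder_cases)
  case greater
  then have Icc: "{c..x} \<subseteq> S" using connected_contains_Icc assms by blast
  have "((\<lambda>y. (f y - f c) / (y - c)) \<longlongrightarrow> D) (at_right c)"
    using has_field_derivative_subset[OF deriv Icc] greater
    by (simp add: has_field_derivative_iff at_within_Icc_at_right)
  moreover have "\<forall>\<^sub>F y in at_right c. (f y - f c) / (y - c) \<le> (f x - f c) / (x - c)"
    using eventually_at_right_real[OF greater]
  proof eventually_elim
    case (elim y)
    then have "f y \<le> (f x - f c) / (x - c) * (y - c) + f c"
      by (intro convex_onD_Icc' convex_on_subset[OF convex Icc]) auto
    then show ?case using elim by (simp add: field_split_simps)
  qed
  ultimately have "D \<le> (f x - f c) / (x - c)" by (simp add: tendsto_upperbound)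
  then show ?thesis using greater by (simp add: field_simps)
next
  case less
  then have Icc: "{x..c} \<subseteq> S" using connected_contains_Icc assms by blast
  have "((\<lambda>y. (f y - f c) / (y - c)) \<longlongrightarrow> D) (at_left c)"
    using has_field_derivative_subset[OF deriv Icc] less
    by (simp add: has_field_derivative_iff at_within_Icc_at_left)
  moreover have "\<forall>\<^sub>F y in at_left c. (f x - f c) / (x - c) \<le> (f y - f c) / (y - c)"
    using eventually_at_left_real[OF less]
  proof eventually_elim
    case (elim y)
    then have "f y \<le> (f x - f c) / (c - x) * (c - y) + f c"
      by (intro convex_onD_Icc'' convex_on_subset[OF convex Icc]) auto
    then show ?case using elim by (simp add: field_split_simps)
  qed
  ultimately have "(f x - f c) / (x - c) \<le> D" by (simp add: tendsto_lowerbound)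
  then show ?thesis using less by (simp add: field_simps)
qed simp

lemma convex_on_derivative_mono:
  fixes f :: "real \<Rightarrow> real"
  assumes "convex_on S f" "connected S"
    and "\<And>x. x \<in> S \<Longrightarrow> (f has_real_derivative f' x) (at x within S)"
  shows "mono_on S f'"
proof (rule mono_onI)
  fix a b assume ab: "a \<in> S" "b \<in> S" "a \<le> b"
  have "f' a * (b - a) \<le> f b - f a" "f' b * (a - b) \<le> f a - f b"
    using convex_on_above_tangent_within[OF assms(1,2)] assms(3) ab by auto
  then have "(f' a - f' b) * (b - a) \<le> 0" by (simp add: algebra_simps)
  then show "f' a \<le> f' b" using ab by (cases "a = b") (auto simp: mult_le_0_iff)
qed

lemma concave_below_tangent_within:
  fixes f :: "real \<Rightarrow> real"
  assumes "convex_on S (\<lambda>x. - f x)" "connected S" "c \<in> S" "x \<in> S"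
    and "(f has_real_derivative D) (at c within S)"
  shows "f x - f c \<le> D * (x - c)"
  using convex_on_above_tangent_within[OF assms(1-4) DERIV_minus[OF assms(5)]] by simp

lemma strict_concave_mono_derivative_pos:
  fixes f :: "real \<Rightarrow> real"
  assumes concave: "strict_concave_on {0..} f" and mono: "mono_on {0..} f"
    and deriv: "(f has_real_derivative D) (at c within {0..})" and "c \<ge> 0"
  shows "D > 0"
proof (rule ccontr)
  assume "\<not> D > 0"
  have "convex_on {0..} (\<lambda>x. - f x)"
    using concave by (simp add: strict_concave_on_def strict_convex_on_imp_convex_on)
  then have tangent: "f x - f c \<le> D * (x - c)" if "x \<ge> 0" for x
    using concave_below_tangent_within[OF _ connected_Ici _ _ deriv] \<open>c \<ge> 0\<close> that by simp
  have flat: "f x = f c" if "x \<ge> c" for x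
  proof (rule order_antisym)
    have "D * (x - c) \<le> 0" using \<open>\<not> D > 0\<close> that by (simp add: mult_nonpos_nonneg)
    then show "f x \<le> f c" using tangent[of x] \<open>c \<ge> 0\<close> that by simp
    show "f c \<le> f x" using \<open>c \<ge> 0\<close> that by (intro mono_onD[OF mono]) auto
  qed
  \<comment> \<open>f is constant on [c, c + 2], contradicting strict concavity at the midpoint c + 1\<close>
  have "- f ((1/2) * c + (1 - 1/2) * (c + 2)) < (1/2) * - f c + (1 - 1/2) * - f (c + 2)"
    using concave \<open>c \<ge> 0\<close> unfolding strict_concave_on_def strict_convex_on_def
    by (elim conjE ballE[of _ _ c] ballE[of _ _ "c + 2"] allE[of _ "1/2"]) auto
  moreover have "(1/2) * c + (1 - 1/2) * (c + 2) = c + 1" by (simp add: field_simps)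
  ultimately show False using flat[of "c + 1"] flat[of "c + 2"] by simp
qed

lemma inv_into_mono_on:
  fixes f :: "'a::linorder \<Rightarrow> 'b::linorder"
  assumes "mono_on S f" "y1 \<in> f ` S" "y2 \<in> f ` S" "y1 \<le> y2"
  shows "inv_into S f y1 \<le> inv_into S f y2"
proof (rule ccontr)
  assume less: "\<not> inv_into S f y1 \<le> inv_into S f y2"
  then have "f (inv_into S f y2) \<le> f (inv_into S f y1)"
    using assms by (intro mono_onD[OF assms(1)] inv_into_into) auto
  then have "y1 = y2" using assms by (simp add: f_inv_into_f)
  then show False using less by simp
qed

lemma inv_into_antimono_on:
  fixes f :: "'a::linorder \<Rightarrow> 'b::linorder"
  assumes "antimono_on S f" "y1 \<in> f ` S" "y2 \<in> f ` S" "y1 \<le> y2"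
  shows "inv_into S f y2 \<le> inv_into S f y1"
proof (rule ccontr)
  assume less: "\<not> inv_into S f y2 \<le> inv_into S f y1"
  then have "f (inv_into S f y2) \<le> f (inv_into S f y1)"
    using assms by (intro monotone_onD[OF assms(1)] inv_into_into) auto
  then have "y1 = y2" using assms by (simp add: f_inv_into_f)
  then show False using less by simp
qed

lemma atLeast_subset_image_if_filterlim_at_top:
  fixes f :: "real \<Rightarrow> real"
  assumes "continuous_on {a..} f" "filterlim f at_top at_top"
  shows "{f a..} \<subseteq> f ` {a..}"
proof
  fix y assume y: "y \<in> {f a..}"
  obtain N where "\<forall>x\<ge>N. y \<le> f x"
    using assms(2) by (auto simp: filterlim_at_top eventually_at_top_linorder)
  then have "a \<le> max a N" "y \<le> f (max a N)" by auto
  then obtain x where "a \<le> x" "f x = y"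
    using IVT'[of f a y "max a N"] y continuous_on_subset[OF assms(1)] by fastforce
  then show "y \<in> f ` {a..}" by auto
qed

lemma greaterThan_0_subset_image_if_tendsto:
  fixes f :: "real \<Rightarrow> real"
  assumes "continuous_on {0<..} f" "filterlim f at_top (at_right 0)" "(f \<longlongrightarrow> 0) at_top"
  shows "{0<..} \<subseteq> f ` {0<..}"
proof
  fix y :: real assume "y \<in> {0<..}"
  have "\<forall>\<^sub>F x in at_right 0. y \<le> f x"
    using assms(2) unfolding filterlim_at_top by blast
  then obtain e where e: "e > 0" "\<forall>x>0. x < e \<longrightarrow> y \<le> f x"
    unfolding eventually_at_right_field by blast
  define a where "a = e / 2"
  have a: "a > 0" "y \<le> f a" using e by (simp_all add: a_def)
  have "\<forall>\<^sub>F x in at_top. f x < y"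
    using order_tendstoD(2)[OF assms(3)] \<open>y \<in> {0<..}\<close> by simp
  then obtain N where N: "\<forall>x\<ge>N. f x < y"
    unfolding eventually_at_top_linorder by blast
  define b where "b = max a N"
  have b: "a \<le> b" "f b \<le> y" using N by (simp_all add: b_def less_imp_le)
  have "continuous_on {a..b} f"
    using a(1) by (intro continuous_on_subset[OF assms(1)]) auto
  then obtain x where "a \<le> x" "f x = y"
    using IVT2'[OF b(2) a(2) b(1)] by blast
  then show "y \<in> f ` {0<..}" using a(1) by force
qed

lemma C2_with_continuous_on_derivative:
  assumes "C2_with S f f' f''"
  shows "continuous_on S f'"
  using assms unfolding C2_with_def continuous_on_eq_continuous_within
  by (metis DERIV_continuous)

lemma filterlim_derivative_ratio_at_top:
  fixes h \<phi> :: "real \<Rightarrow> real"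
  assumes h_convex: "convex_on {0..} h"
    and h_deriv: "\<And>x. x \<ge> 0 \<Longrightarrow> (h has_real_derivative h' x) (at x within {0..})"
    and "h' 0 > 0"
    and \<phi>_concave: "convex_on {0..} (\<lambda>x. - \<phi> x)"
    and \<phi>_deriv: "\<And>x. x \<ge> 0 \<Longrightarrow> (\<phi> has_real_derivative \<phi>' x) (at x within {0..})"
    and \<phi>'_pos: "\<And>x. x \<ge> 0 \<Longrightarrow> \<phi>' x > 0"
    and \<phi>_bounded: "bounded (\<phi> ` {0..})"
  shows "filterlim (\<lambda>a. h' a / \<phi>' a) at_top at_top"
proof -
  obtain M where "M > 0" and M: "\<And>x. x \<ge> 0 \<Longrightarrow> \<bar>\<phi> x\<bar> \<le> M"
    using \<phi>_bounded unfolding bounded_pos by auto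
  have h'_mono: "mono_on {0..} h'"
    using convex_on_derivative_mono[OF h_convex connected_Ici] h_deriv by simp
  \<comment> \<open>a bounded concave function has \<phi>' a * a \<le> \<phi> a - \<phi> 0, so \<phi>' a = O(1/a)\<close>
  have lower: "h' 0 / (2 * M) * a \<le> h' a / \<phi>' a" if "a \<ge> 0" for a
  proof -
    have "\<phi> 0 - \<phi> a \<le> \<phi>' a * (0 - a)"
      using concave_below_tangent_within[OF \<phi>_concave connected_Ici _ _ \<phi>_deriv[OF that], of 0]
        that by simp
    then have "\<phi>' a * a \<le> 2 * M" using M[of a] M[of 0] that by simp
    then have "h' 0 / (2 * M) * a \<le> h' 0 / \<phi>' a"
      using \<open>M > 0\<close> \<open>h' 0 > 0\<close> \<phi>'_pos[OF that] by (simp add: field_simps)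
    also have "\<dots> \<le> h' a / \<phi>' a"
      using mono_onD[OF h'_mono, of 0 a] \<phi>'_pos[OF that] that by (simp add: divide_right_mono)
    finally show ?thesis .
  qed
  have "filterlim (\<lambda>a. h' 0 / (2 * M) * a) at_top at_top"
    using \<open>M > 0\<close> \<open>h' 0 > 0\<close>
    by (intro filterlim_tendsto_pos_mult_at_top[OF tendsto_const _ filterlim_ident]) simp
  then show ?thesis
    by (rule filterlim_at_top_mono) (intro eventually_mono[OF eventually_ge_at_top[of 0]] lower)
qed

lemma invratio0_nonneg: "0 \<le> invratio0 h' \<phi>' y"
  unfolding invratio0_def using inv_into_into[of y _ "{0::real..}"] by auto

lemma mono_invratio0_if_onto:
  fixes h' \<phi>' :: "real \<Rightarrow> real"
  defines "r \<equiv> \<lambda>a. h' a / \<phi>' a"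
  assumes r_mono: "mono_on {0..} r" and r_onto: "{r 0..} \<subseteq> r ` {0..}"
  shows "mono (invratio0 h' \<phi>')"
proof (rule monoI)
  fix y1 y2 :: real assume "y1 \<le> y2"
  show "invratio0 h' \<phi>' y1 \<le> invratio0 h' \<phi>' y2"
  proof (cases "y1 \<in> r ` {0..}")
    case True
    then have "r 0 \<le> y1" using mono_onD[OF r_mono] by auto
    then have "y2 \<in> r ` {0..}" using \<open>y1 \<le> y2\<close> r_onto by auto
    then show ?thesis
      using inv_into_mono_on[OF r_mono True _ \<open>y1 \<le> y2\<close>] True
      by (simp add: invratio0_def r_def)
  next
    case False
    then show ?thesis using invratio0_nonneg[of h' \<phi>' y2] by (simp add: invratio0_def r_def)
  qed
qed

lemma mono_invratio0:
  fixes \<phi> \<phi>' \<phi>'' h h' h'' :: "real \<Rightarrow> real"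
  assumes \<phi>_C2: "C2_with {0..} \<phi> \<phi>' \<phi>''" and \<phi>_concave: "strict_concave_on {0..} \<phi>"
    and \<phi>_mono: "mono_on {0..} \<phi>" and \<phi>_bounded: "bounded (\<phi> ` {0..})"
    and h_C2: "C2_with {0..} h h' h''" and h_convex: "strict_convex_on {0..} h" and "h' 0 > 0"
  shows "mono (invratio0 h' \<phi>')"
proof -
  have \<phi>_deriv: "\<And>x. x \<ge> 0 \<Longrightarrow> (\<phi> has_real_derivative \<phi>' x) (at x within {0..})"
    and h_deriv: "\<And>x. x \<ge> 0 \<Longrightarrow> (h has_real_derivative h' x) (at x within {0..})"
    using \<phi>_C2 h_C2 by (simp_all add: C2_with_def)
  have \<phi>_cv: "convex_on {0..} (\<lambda>x. - \<phi> x)"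
    using \<phi>_concave by (simp add: strict_concave_on_def strict_convex_on_imp_convex_on)
  have h_cv: "convex_on {0..} h"
    using h_convex by (rule strict_convex_on_imp_convex_on)
  have \<phi>'_pos: "\<And>x. x \<ge> 0 \<Longrightarrow> \<phi>' x > 0"
    using strict_concave_mono_derivative_pos[OF \<phi>_concave \<phi>_mono \<phi>_deriv] .
  have h'_mono: "mono_on {0..} h'"
    using convex_on_derivative_mono[OF h_cv connected_Ici] h_deriv by simp
  have "mono_on {0..} (\<lambda>x. - \<phi>' x)"
    by (rule convex_on_derivative_mono[OF \<phi>_cv connected_Ici]) (auto intro: DERIV_minus \<phi>_deriv)
  then have \<phi>'_anti: "\<phi>' b \<le> \<phi>' a" if "0 \<le> a" "a \<le> b" for a b
    using mono_onD[of "{0..}" "\<lambda>x. - \<phi>' x" a b] that by simp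
  have r_mono: "mono_on {0..} (\<lambda>a. h' a / \<phi>' a)"
  proof (rule mono_onI)
    fix a b :: real assume "a \<in> {0..}" "b \<in> {0..}" "a \<le> b"
    then show "h' a / \<phi>' a \<le> h' b / \<phi>' b"
      using mono_onD[OF h'_mono, of 0 a] mono_onD[OF h'_mono, of a b] \<phi>'_anti[of a b] \<phi>'_pos[of b]
        \<open>h' 0 > 0\<close> by (intro frac_le) auto
  qed
  have "continuous_on {0..} (\<lambda>a. h' a / \<phi>' a)"
    using C2_with_continuous_on_derivative[OF h_C2] C2_with_continuous_on_derivative[OF \<phi>_C2] \<phi>'_pos
    by (intro continuous_on_divide) (auto simp: less_imp_neq[symmetric])
  from atLeast_subset_image_if_filterlim_at_top[OF this filterlim_derivative_ratio_at_top]
  have "{h' 0 / \<phi>' 0..} \<subseteq> (\<lambda>a. h' a / \<phi>' a) ` {0..}"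
    using h_cv h_deriv \<open>h' 0 > 0\<close> \<phi>_cv \<phi>_deriv \<phi>'_pos \<phi>_bounded by blast
  then show ?thesis by (rule mono_invratio0_if_onto[OF r_mono])
qed

lemma invU'_antimono_pos:
  fixes U U' U'' :: "real \<Rightarrow> real"
  assumes U_C2: "C2_with {0<..} U U' U''" and U_concave: "strict_concave_on {0..} U"
    and "filterlim U' at_top (at_right 0)" "(U' \<longlongrightarrow> 0) at_top"
  shows "antimono_on {0<..} (invU' U')" and "0 < y \<Longrightarrow> 0 < invU' U' y"
proof -
  have onto: "{0<..} \<subseteq> U' ` {0<..}"
    using greaterThan_0_subset_image_if_tendsto[OF C2_with_continuous_on_derivative[OF U_C2] assms(3,4)] .
  have "convex_on {0<..} (\<lambda>x. - U x)"
    using U_concave by (auto simp: strict_concave_on_def intro: convex_on_subset strict_convex_on_imp_convex_on)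
  then have "mono_on {0<..} (\<lambda>x. - U' x)"
    by (rule convex_on_derivative_mono[OF _ connected_Ioi])
      (use U_C2 in \<open>auto simp: C2_with_def intro: DERIV_minus\<close>)
  then have U'_anti: "antimono_on {0<..} U'"
    by (auto simp: monotone_on_def)
  show "antimono_on {0<..} (invU' U')"
    unfolding invU'_def by (intro monotone_onI inv_into_antimono_on[OF U'_anti]) (use onto in auto)
  show "0 < invU' U' y" if "0 < y"
    using inv_into_into[of y U' "{0<..}"] onto that by (auto simp: invU'_def)
qed

lemma Gfun_mono_on:
  assumes U_mono: "mono_on {0..} U" and h_mono: "mono_on {0..} h"
    and invU'_anti: "antimono_on {0<..} (invU' U')" and invU'_pos: "\<And>y. 0 < y \<Longrightarrow> 0 < invU' U' y"
    and invratio0_mono: "mono (invratio0 h' \<phi>')"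
  shows "mono_on {L. 0 < L \<and> Gfun U U' h h' \<phi>' lam delta L \<noteq> 0} (Gfun U U' h h' \<phi>' lam delta)"
proof (rule mono_onI)
  define F where "F L s = exp (- lam * s) *
    (U (invU' U' (exp ((lam - delta) * s) / L)) - h (invratio0 h' \<phi>' (exp ((lam - delta) * s) / L)))"
    for L s
  have G: "Gfun U U' h h' \<phi>' lam delta L = (LINT s:{0..}|lborel. F L s)" for L
    by (simp add: Gfun_def F_def)
  \<comment> \<open>a non-integrable function has Bochner integral 0, so a nonzero value certifies integrability\<close>
  have integrable: "set_integrable lborel {0..} (F L)" if "Gfun U U' h h' \<phi>' lam delta L \<noteq> 0" for L
    using that not_integrable_integral_eq
    unfolding G set_lebesgue_integral_def set_integrable_def by blast
  fix L1 L2 assume L1: "L1 \<in> {L. 0 < L \<and> Gfun U U' h h' \<phi>' lam delta L \<noteq> 0}"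
    and L2: "L2 \<in> {L. 0 < L \<and> Gfun U U' h h' \<phi>' lam delta L \<noteq> 0}" and "L1 \<le> L2"
  have "F L1 s \<le> F L2 s" for s
  proof -
    define y1 y2 where "y1 = exp ((lam - delta) * s) / L1" and "y2 = exp ((lam - delta) * s) / L2"
    have y: "0 < y2" "y2 \<le> y1"
      using L1 L2 \<open>L1 \<le> L2\<close> by (auto simp: y1_def y2_def intro: divide_left_mono)
    have "U (invU' U' y1) \<le> U (invU' U' y2)"
      using monotone_onD[OF invU'_anti _ _ y(2)] invU'_pos y
      by (intro mono_onD[OF U_mono]) (auto simp: less_imp_le)
    moreover have "h (invratio0 h' \<phi>' y2) \<le> h (invratio0 h' \<phi>' y1)"
      using monoD[OF invratio0_mono y(2)] invratio0_nonneg
      by (intro mono_onD[OF h_mono]) auto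
    ultimately show ?thesis
      unfolding F_def y1_def[symmetric] y2_def[symmetric] by (intro mult_left_mono) auto
  qed
  then show "Gfun U U' h h' \<phi>' lam delta L1 \<le> Gfun U U' h h' \<phi>' lam delta L2"
    unfolding G using integrable L1 L2 by (intro set_integral_mono) auto
qed

lemma mono_on_if_right_inverse:
  fixes g :: "'a::linorder \<Rightarrow> 'b::linorder"
  assumes inverse: "\<And>x. x \<in> X \<Longrightarrow> g x \<in> P \<and> G (g x) = x" and "mono_on P G"
  shows "mono_on X g"
proof (rule mono_onI, rule ccontr)
  fix x1 x2 assume x: "x1 \<in> X" "x2 \<in> X" "x1 \<le> x2" and "\<not> g x1 \<le> g x2"
  then have "G (g x2) \<le> G (g x1)"
    using inverse by (intro mono_onD[OF \<open>mono_on P G\<close>]) auto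
  then have "x1 = x2" using inverse x by fastforce
  then show False using \<open>\<not> g x1 \<le> g x2\<close> by simp
qed

lemma mono_on_Gfun_solution:
  assumes "mono_on {0..} U" "mono_on {0..} h"
    and "antimono_on {0<..} (invU' U')" "\<And>y. 0 < y \<Longrightarrow> 0 < invU' U' y"
    and "mono (invratio0 h' \<phi>')"
    and "X \<subseteq> {0<..}" "\<forall>x\<in>X. lagr x > 0 \<and> Gfun U U' h h' \<phi>' lam delta (lagr x) = x"
  shows "mono_on X lagr"
proof (rule mono_on_if_right_inverse)
  show "mono_on {L. 0 < L \<and> Gfun U U' h h' \<phi>' lam delta L \<noteq> 0} (Gfun U U' h h' \<phi>' lam delta)"
    by (rule Gfun_mono_on[OF assms(1-5)])
qed (use assms(6,7) in fastforce)

theorem proposition3p4: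
  fixes \<phi> \<phi>' \<phi>'' U U' U'' h h' h'' :: "real \<Rightarrow> real"
    and lam delta :: real
    and X :: "real set"
    and lagr :: "real \<Rightarrow> real"
  assumes phi_C2: "C2_with {0..} \<phi> \<phi>' \<phi>''"
    and phi_nonneg: "\<forall>a\<ge>0. \<phi> a \<ge> 0"
    and phi_conc: "strict_concave_on {0..} \<phi>"
    and phi_bdd: "bounded (\<phi> ` {0..})"
    and phi_mono: "mono_on {0..} \<phi>"
    and phi0: "\<phi> 0 = 0"
    and phi'0: "\<phi>' 0 > 0"
    and U_cont: "continuous_on {0..} U"
    and U_C2: "C2_with {0<..} U U' U''"
    and U_nonneg: "\<forall>r\<ge>0. U r \<ge> 0"
    and U_conc: "strict_concave_on {0..} U"
    and U_mono: "mono_on {0..} U"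
    and U0: "U 0 = 0"
    and U'_top: "(U' \<longlongrightarrow> 0) at_top"
    and U'_0: "filterlim U' at_top (at_right 0)"
    and h_C2: "C2_with {0..} h h' h''"
    and h_nonneg: "\<forall>a\<ge>0. h a \<ge> 0"
    and h_conv: "strict_convex_on {0..} h"
    and h_mono: "mono_on {0..} h"
    and h0: "h 0 = 0"
    and h'0: "h' 0 > 0"
    and rates: "lam \<ge> delta" "delta > 0"
    and X_pos: "X \<subseteq> {0<..}"
    and lagr_sol: "\<forall>x\<in>X. lagr x > 0 \<and> Gfun U U' h h' \<phi>' lam delta (lagr x) = x"
    and t: "t \<ge> 0"
  shows "mono_on X (\<lambda>x. Rstar U' lam delta (lagr x) t)
       \<and> antimono_on X (\<lambda>x. Astar h' \<phi>' lam delta (lagr x) t)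
       \<and> antimono_on X (\<lambda>x. \<phi> (Astar h' \<phi>' lam delta (lagr x) t) - Rstar U' lam delta (lagr x) t)"
proof -
  note invU' = invU'_antimono_pos[OF U_C2 U_conc U'_0 U'_top]
  note invratio0_mono = mono_invratio0[OF phi_C2 phi_conc phi_mono phi_bdd h_C2 h_conv h'0]
  have "mono_on X lagr"
    using mono_on_Gfun_solution[OF U_mono h_mono invU' invratio0_mono X_pos lagr_sol] .
  define y where "y x = exp ((lam - delta) * t) / lagr x" for x
  have y: "0 < y x2" "y x2 \<le> y x1" if "x1 \<in> X" "x2 \<in> X" "x1 \<le> x2" for x1 x2
    using mono_onD[OF \<open>mono_on X lagr\<close> that] lagr_sol that
    by (auto simp: y_def intro: divide_left_mono)
  have R: "invU' U' (y x1) \<le> invU' U' (y x2)"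
    and A: "invratio0 h' \<phi>' (y x2) \<le> invratio0 h' \<phi>' (y x1)"
    if "x1 \<in> X" "x2 \<in> X" "x1 \<le> x2" for x1 x2
    using monotone_onD[OF invU'(1) _ _ y(2)[OF that]] monoD[OF invratio0_mono y(2)[OF that]]
      y(1)[OF that] y(1)[of x1 x1] that by auto
  have \<phi>A: "\<phi> (invratio0 h' \<phi>' (y x2)) \<le> \<phi> (invratio0 h' \<phi>' (y x1))"
    if "x1 \<in> X" "x2 \<in> X" "x1 \<le> x2" for x1 x2
    using A[OF that] invratio0_nonneg by (intro mono_onD[OF phi_mono]) auto
  show ?thesis
    unfolding Rstar_def Astar_def y_def[symmetric]
    using R A \<phi>A by (intro conjI monotone_onI) (auto intro: diff_mono)
qed

end
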